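(* Let $\mathcal{T}$ be the rooted tree whose vertices are all plane permutations of size $\geq 1$, whose root is the permutation $1$ of size $1$, and in which the children of a plane permutation $\pi$ of size $n$ are exactly the permutations $\pi\cdot a$, $a\in\{1,\dots,n+1\}$, that are plane. Then $\mathcal{T}$ is a generating tree for plane permutations (every plane permutation of size $n$ appears exactly once, at level $n$), and $\mathcal{T}$ is isomorphic (as a rooted tree) to the tree generated by the succession rule $$\Omega_{semi}=\left\{\begin{array}{l}(1,1)\\ (h,k)\rightsquigarrow (1,k+1),\dots,(h,k+1),\\ \phantom{(h,k)\rightsquigarrow{}}(h+k,1),(h+k-1,2),\dots,(h+1,k).\end{array}\right.$$
   Context: A permutation $\pi=\pi_1\cdots\pi_n$ of $\{1,\dots,n\}$ is plane if there are no indices $i<j$ and $k>j+1$ with $\pi_{j}<\pi_i<\pi_k<\pi_{j+1}$ (that is, $\pi$ avoids the vincular pattern $2143$ in which the entries $1$ and $4$ must be adjacent). For a permutation $\pi$ of size $n$ and $a\in\{1,\dots,n+1\}$, $\pi\cdot a$ (insertion of $a$ on the right) is the permutation $\pi'$ of size $n+1$ with $\pi'_{n+1}=a$ and, for $i\leq n$, $\pi'_i=\pi_i$ if $\pi_i<a$ and $\pi'_i=\pi_i+1$ if $\pi_i\geq a$. A generating tree for a class of objects is an infinite rooted tree whose vertices are the objects, each appearing exactly once, objects of size $n$ being at level $n$ (the root is at level $1$). A succession rule consists of a root label and productions $\ell\rightsquigarrow \ell_1,\dots,\ell_m$; the tree it generates is the rooted tree with labelled nodes in which the root has the root label and every node labelled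 $\ell$ has $m$ children labelled $\ell_1,\dots,\ell_m$. In $\Omega_{semi}$, a node labelled $(h,k)$ has the $h$ children $(i,k+1)$, $1\leq i\leq h$, and the $k$ children $(h+k+1-i,i)$, $1\leq i\leq k$. *)

theory Defs
  imports "HOL-Combinatorics.Multiset_Permutations"
begin

text \<open>
  Rooted trees are given by a vertex set, a root and the set of (parent, child) pairs.
\<close>

record 'v rooted_graph =
  verts :: "'v set"
  root :: 'v
  edges :: "('v \<times> 'v) set"

definition root_path :: "'v rooted_graph \<Rightarrow> 'v list \<Rightarrow> 'v \<Rightarrow> bool" where
  "root_path T p v \<longleftrightarrow>
     p \<noteq> [] \<and> hd p = root T \<and> last p = v \<and> successively (\<lambda>x y. (x, y) \<in> edges T) p"

definition rooted_tree :: "'v rooted_graph \<Rightarrow> bool" where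
  "rooted_tree T \<longleftrightarrow>
     root T \<in> verts T \<and> edges T \<subseteq> verts T \<times> verts T \<and> (\<forall>v\<in>verts T. \<exists>!p. root_path T p v)"

text \<open>The level counts the vertices on the path from the root, so the root is at level 1.\<close>

definition level :: "'v rooted_graph \<Rightarrow> 'v \<Rightarrow> nat" where
  "level T v = length (THE p. root_path T p v)"

definition rooted_iso :: "'v rooted_graph \<Rightarrow> 'w rooted_graph \<Rightarrow> bool" where
  "rooted_iso T T' \<longleftrightarrow>
     (\<exists>f. bij_betw f (verts T) (verts T') \<and> f (root T) = root T' \<and>
          (\<forall>x\<in>verts T. \<forall>y\<in>verts T. (x, y) \<in> edges T \<longleftrightarrow> (f x, f y) \<in> edges T'))"

definition generating_tree :: "'v set \<Rightarrow> ('v \<Rightarrow> nat) \<Rightarrow> 'v rooted_graph \<Rightarrow> bool" where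
  "generating_tree C sz T \<longleftrightarrow>
     rooted_tree T \<and> infinite (verts T) \<and> verts T = C \<and> (\<forall>x\<in>C. level T x = sz x)"

record 'l succession_rule =
  root_label :: 'l
  productions :: "'l \<Rightarrow> 'l list"

text \<open>
  A node of the tree generated by a rule is a pair of its address (the list of the child
  indices, counted from 0, on the way down from the root) and its label. The address keeps
  distinct nodes with equal labels apart.
\<close>

inductive_set rule_nodes :: "'l succession_rule \<Rightarrow> (nat list \<times> 'l) set"
  for R :: "'l succession_rule" where
  root: "([], root_label R) \<in> rule_nodes R"
| child: "(p, l) \<in> rule_nodes R \<Longrightarrow> i < length (productions R l) \<Longrightarrow>
           (p @ [i], productions R l ! i) \<in> rule_nodes R"

definition rule_tree :: "'l succession_rule \<Rightarrow> (nat list \<times> 'l) rooted_graph" where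
  "rule_tree R = \<lparr>
     verts = rule_nodes R,
     root = ([], root_label R),
     edges = {((p, l), (p @ [i], productions R l ! i)) | p l i.
                (p, l) \<in> rule_nodes R \<and> i < length (productions R l)}\<rparr>"

definition Omega_semi :: "(nat \<times> nat) succession_rule" where
  "Omega_semi = \<lparr>
     root_label = (1, 1),
     productions = (\<lambda>(h, k). map (\<lambda>i. (i, k + 1)) [1..<h + 1] @
                             map (\<lambda>i. (h + k + 1 - i, i)) [1..<k + 1])\<rparr>"

text \<open>
  Permutations of \<open>{1..n}\<close> are written in one-line notation as lists of length \<open>n\<close>.
  Positions are counted from 0; the values are \<open>1, \<dots>, n\<close>.
\<close>

definition plane :: "nat list \<Rightarrow> bool" where
  "plane \<pi> \<longleftrightarrow>
     \<not> (\<exists>i j k. i < j \<and> j + 1 < k \<and> k < length \<pi> \<and>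
          \<pi> ! j < \<pi> ! i \<and> \<pi> ! i < \<pi> ! k \<and> \<pi> ! k < \<pi> ! (j + 1))"

definition plane_perms :: "nat list set" where
  "plane_perms = {\<pi>. \<exists>n\<ge>1. \<pi> \<in> permutations_of_set {1..n} \<and> plane \<pi>}"

definition insert_right :: "nat list \<Rightarrow> nat \<Rightarrow> nat list" where
  "insert_right \<pi> a = map (\<lambda>x. if x < a then x else x + 1) \<pi> @ [a]"

definition plane_tree :: "nat list rooted_graph" where
  "plane_tree = \<lparr>
     verts = plane_perms,
     root = [1],
     edges = {(\<pi>, insert_right \<pi> a) | \<pi> a.
                \<pi> \<in> plane_perms \<and> a \<in> {1..length \<pi> + 1} \<and> plane (insert_right \<pi> a)}\<rparr>"

end

theory Submission
  imports Defs
begin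

text \<open>
  Every plane permutation of size at least 2 arises from exactly one smaller plane permutation:
  delete the last entry and close the gap in the values. So each vertex other than the root has
  a unique parent, of size one less, which makes the graph a tree with the size as level.

  The shape of the tree is read off from the active sites of \<open>\<pi>\<close>, the values \<open>a\<close> for which
  \<open>\<pi> \<cdot> a\<close> is plane. Inserting \<open>a\<close> can only create an occurrence of \<open>2143\<close> whose \<open>3\<close> is \<open>a\<close>, so \<open>a\<close> is
  active unless \<open>\<pi>\<^sub>j < \<pi>\<^sub>i < a \<le> \<pi>\<^bsub>j+1\<^esub>\<close> for some \<open>i < j\<close>. Passing to \<open>\<pi> \<cdot> a\<close> splits the site \<open>a\<close> into \<open>a\<close>
  and \<open>a + 1\<close>. If moreover \<open>a\<close> lies above the last entry \<open>z\<close> of \<open>\<pi>\<close>, then the new ascent \<open>z a\<close>, with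
  the earlier values larger than \<open>z\<close> in the role of \<open>2\<close>, deactivates the sites \<open>z + 2, \<dots>, a\<close>, while
  \<open>z + 1\<close> stays active (lemma \<open>sites_insert_right\<close>).

  Let \<open>h\<close> and \<open>k\<close> be the numbers of active sites above \<open>z\<close> and not above \<open>z\<close>. Inserting at the
  \<open>r\<close>-th site from the top among the upper ones leaves \<open>r\<close> sites above the new last entry \<open>a\<close> and
  the \<open>k\<close> lower sites together with \<open>z + 1\<close> not above it, hence the label \<open>(r, k + 1)\<close>. Inserting at the
  \<open>r\<close>-th site from the top among the lower ones gives \<open>(h + r, k + 1 - r)\<close>. These are the
  productions of the rule (lemma \<open>label_insert_right\<close>).

  The labels that the rule produces from \<open>(h, k)\<close> are pairwise distinct, so a child is determined by
  its parent and its own label. Following the addresses of the rule's nodes down the tree of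
  permutations is then an isomorphism (lemma \<open>rooted_iso_rule_tree_distinct\<close>).
\<close>

section \<open>Trees graded by a size function\<close>

text \<open>
  A local criterion for being a rooted tree: unique parents give uniqueness of the path from the
  root. As the size drops from child to parent, climbing to parents ends, and it can only end at
  the root; the root in turn, having the least size, has no parent.
\<close>
locale graded_tree =
  fixes T :: "'v rooted_graph" and sz :: "'v \<Rightarrow> nat"
  assumes root_in_verts: "root T \<in> verts T"
    and edges_subset: "edges T \<subseteq> verts T \<times> verts T"
    and size_root: "sz (root T) = 1"
    and size_pos: "v \<in> verts T \<Longrightarrow> 1 \<le> sz v"
    and size_edge: "(u, v) \<in> edges T \<Longrightarrow> sz v = Suc (sz u)"
    and parent_ex1: "v \<in> verts T \<Longrightarrow> v \<noteq> root T \<Longrightarrow> \<exists>!u. (u, v) \<in> edges T"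
begin

lemma no_edge_into_root: "(u, root T) \<notin> edges T"
  using edges_subset size_edge[of u "root T"] size_pos[of u] size_root by auto

lemma parent_unique:
  assumes "(u, v) \<in> edges T" "(u', v) \<in> edges T"
  shows "u = u'"
  using assms parent_ex1[of v] no_edge_into_root edges_subset by blast

lemma vertex_induct [consumes 1, case_names root edge]:
  assumes "v \<in> verts T"
    and "P (root T)"
    and "\<And>u v. u \<in> verts T \<Longrightarrow> (u, v) \<in> edges T \<Longrightarrow> P u \<Longrightarrow> P v"
  shows "P v"
  using assms(1)
proof (induction "sz v" arbitrary: v rule: less_induct)
  case less
  show ?case
  proof (cases "v = root T")
    case False
    then obtain u where u: "(u, v) \<in> edges T" using parent_ex1 less.prems by blast
    then have "u \<in> verts T" using edges_subset by blast
    then show ?thesis using less.hyps[of u] size_edge[OF u] assms(3) u by simp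
  qed (simp add: assms(2))
qed

text \<open>
  Paths are extended at the end, since the hypotheses speak about the edge into a vertex.
\<close>
lemma root_path_snoc:
  "root_path T (p @ [v]) w \<longleftrightarrow>
     w = v \<and> (p = [] \<and> v = root T \<or> (\<exists>u. root_path T p u \<and> (u, v) \<in> edges T))"
  by (cases "p = []") (auto simp: root_path_def successively_append_iff)

lemma length_root_path: "root_path T p v \<Longrightarrow> length p = sz v"
proof (induction p arbitrary: v rule: rev_induct)
  case Nil
  then show ?case by (simp add: root_path_def)
next
  case (snoc x p)
  then show ?case using size_root size_edge by (auto simp: root_path_snoc)
qed

lemma root_path_exists: "v \<in> verts T \<Longrightarrow> \<exists>p. root_path T p v"
proof (induction v rule: vertex_induct)
  case root
  show ?case using root_path_snoc[of "[]"] by blast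
next
  case (edge u v)
  then show ?case using root_path_snoc by blast
qed

lemma root_path_unique: "root_path T p v \<Longrightarrow> root_path T q v \<Longrightarrow> p = q"
proof (induction p arbitrary: q v rule: rev_induct)
  case Nil
  then show ?case by (simp add: root_path_def)
next
  case (snoc x p)
  from snoc.prems(2) obtain q' y where q: "q = q' @ [y]"
    by (cases q rule: rev_cases) (auto simp: root_path_def)
  from snoc.prems q have xy: "x = v" "y = v" by (simp_all add: root_path_snoc)
  show ?case
  proof (cases "v = root T")
    case True
    then show ?thesis using snoc.prems q xy no_edge_into_root by (auto simp: root_path_snoc)
  next
    case False
    then obtain u u' where "root_path T p u" "(u, v) \<in> edges T" "root_path T q' u'" "(u', v) \<in> edges T"
      using snoc.prems q xy by (auto simp: root_path_snoc)
    then show ?thesis using parent_unique snoc.IH q xy by blast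
  qed
qed

lemma rooted_tree: "rooted_tree T"
  unfolding rooted_tree_def
  using root_in_verts edges_subset root_path_exists root_path_unique by blast

lemma level_eq_size:
  assumes "v \<in> verts T"
  shows "level T v = sz v"
proof -
  obtain p where p: "root_path T p v" using root_path_exists assms by blast
  then have "(THE p. root_path T p v) = p" using root_path_unique by blast
  then show ?thesis using length_root_path[OF p] by (simp add: level_def)
qed

end

section \<open>Isomorphism with the tree of a succession rule\<close>

lemma rule_nodes_snocE:
  assumes "(p @ [i], l) \<in> rule_nodes R"
  obtains m where "(p, m) \<in> rule_nodes R" "i < length (productions R m)" "l = productions R m ! i"
  using assms by (auto elim: rule_nodes.cases)

text \<open>
  An enumeration \<open>c v\<close> of the children of every vertex, compatible with the labels, turns an
  address into a vertex by successive descents from the root. This decoding is the isomorphism: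
  it is onto because every vertex is reached by descents, and injective because a vertex
  determines its parent, and the parent determines the last index of the address.
\<close>
lemma (in graded_tree) rooted_iso_rule_tree:
  fixes R :: "'l succession_rule" and lab :: "'v \<Rightarrow> 'l" and c :: "'v \<Rightarrow> nat \<Rightarrow> 'v"
  assumes lab_root: "lab (root T) = root_label R"
    and c_bij: "\<And>v. v \<in> verts T \<Longrightarrow>
      bij_betw (c v) {..<length (productions R (lab v))} {w. (v, w) \<in> edges T}"
    and lab_c: "\<And>v i. v \<in> verts T \<Longrightarrow> i < length (productions R (lab v)) \<Longrightarrow>
      lab (c v i) = productions R (lab v) ! i"
  shows "rooted_iso T (rule_tree R)"
proof -
  define d where "d = foldl c (root T)"
  have d_Nil: "d [] = root T" and d_snoc: "\<And>p i. d (p @ [i]) = c (d p) i"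
    by (simp_all add: d_def)
  have edge_c: "(v, c v i) \<in> edges T" if "v \<in> verts T" "i < length (productions R (lab v))" for v i
    using bij_betwE[OF c_bij[OF that(1)]] that(2) by auto
  have node: "d p \<in> verts T \<and> lab (d p) = l" if "(p, l) \<in> rule_nodes R" for p l
    using that
  proof (induction rule: rule_nodes.induct)
    case root
    show ?case using root_in_verts lab_root by (simp add: d_Nil)
  next
    case (child p l i)
    then show ?case using edge_c[of "d p" i] edges_subset lab_c[of "d p" i] by (auto simp: d_snoc)
  qed
  have d_edge: "(d p, d (p @ [i])) \<in> edges T" if "(p @ [i], l) \<in> rule_nodes R" for p i l
    using rule_nodes_snocE[OF that] node edge_c[of "d p" i] by (auto simp: d_snoc)
  have d_snoc_neq: "d (p @ [i]) \<noteq> root T" if "(p @ [i], l) \<in> rule_nodes R" for p i l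
    using d_edge[OF that] no_edge_into_root by auto
  have d_inj: "p = q" if "(p, l) \<in> rule_nodes R" "(q, m) \<in> rule_nodes R" "d p = d q" for p q l m
    using that
  proof (induction p arbitrary: q l m rule: rev_induct)
    case Nil
    then show ?case using d_snoc_neq by (cases q rule: rev_cases) (auto simp: d_Nil)
  next
    case (snoc i p)
    have "q \<noteq> []" using snoc.prems d_snoc_neq by (auto simp: d_Nil)
    then obtain q' j where q: "q = q' @ [j]" by (cases q rule: rev_cases) auto
    obtain l' where l': "(p, l') \<in> rule_nodes R" "i < length (productions R l')"
      using rule_nodes_snocE[OF snoc.prems(1)] by blast
    obtain m' where m': "(q', m') \<in> rule_nodes R" "j < length (productions R m')"
      using rule_nodes_snocE[OF snoc.prems(2)[unfolded q]] by blast
    have "d p = d q'"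
      using parent_unique[OF d_edge[OF snoc.prems(1)]] d_edge[OF snoc.prems(2)[unfolded q]]
        snoc.prems(3) q by simp
    then have "p = q'" using snoc.IH l'(1) m'(1) by blast
    moreover from this have "l' = m'" using node l'(1) m'(1) by blast
    moreover have "c (d p) i = c (d p) j" using snoc.prems(3) \<open>p = q'\<close> by (simp add: q d_snoc)
    ultimately have "i = j"
      using bij_betw_imp_inj_on[OF c_bij[of "d p"]] l' m' node[OF l'(1)] by (auto dest: inj_onD)
    then show ?case using \<open>p = q'\<close> q by simp
  qed
  have d_surj: "\<exists>p l. (p, l) \<in> rule_nodes R \<and> d p = v" if "v \<in> verts T" for v
    using that
  proof (induction v rule: vertex_induct)
    case root
    show ?case using rule_nodes.root d_Nil by blast
  next
    case (edge u v)
    then obtain p l where pl: "(p, l) \<in> rule_nodes R" "d p = u" by blast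
    then have "lab u = l" using node by blast
    moreover obtain i where "i < length (productions R (lab u))" "v = c u i"
      using bij_betw_imp_surj_on[OF c_bij[OF edge.hyps(1)]] edge.hyps(2) by blast
    ultimately show ?case using rule_nodes.child[OF pl(1)] pl(2) d_snoc by blast
  qed
  define g where "g = (\<lambda>(p, l :: 'l). d p)"
  have g_inj: "inj_on g (rule_nodes R)"
  proof (rule inj_onI)
    fix x y assume "x \<in> rule_nodes R" "y \<in> rule_nodes R" "g x = g y"
    then show "x = y" using d_inj node by (cases x; cases y) (auto simp: g_def, metis+)
  qed
  have g_img: "g ` rule_nodes R = verts T"
    using node d_surj by (force simp: g_def image_iff)
  have g_edge: "(x, y) \<in> edges (rule_tree R) \<longleftrightarrow> (g x, g y) \<in> edges T"
    if x: "x \<in> rule_nodes R" and y: "y \<in> rule_nodes R" for x y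
  proof
    assume "(x, y) \<in> edges (rule_tree R)"
    then show "(g x, g y) \<in> edges T"
      using d_edge y by (auto simp: rule_tree_def g_def)
  next
    assume e: "(g x, g y) \<in> edges T"
    obtain p l where xp: "x = (p, l)" by (cases x)
    have dp: "d p \<in> verts T" "lab (d p) = l" using node x xp by auto
    obtain i where i: "i < length (productions R l)" "g y = c (d p) i"
      using bij_betw_imp_surj_on[OF c_bij[OF dp(1)]] e dp(2) xp by (auto simp: g_def)
    let ?z = "(p @ [i], productions R l ! i)"
    have "?z \<in> rule_nodes R" using rule_nodes.child[of p l R i] x xp i by simp
    moreover have "g y = g ?z" using i by (simp add: g_def d_snoc)
    ultimately have "y = ?z" using g_inj y by (auto dest: inj_onD)
    then show "(x, y) \<in> edges (rule_tree R)" using x xp i by (auto simp: rule_tree_def)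
  qed
  define f where "f = inv_into (rule_nodes R) g"
  have g_bij: "bij_betw g (rule_nodes R) (verts T)" using g_inj g_img by (simp add: bij_betw_def)
  have f_bij: "bij_betw f (verts T) (rule_nodes R)"
    unfolding f_def by (rule bij_betw_inv_into[OF g_bij])
  have gf: "g (f v) = v" if "v \<in> verts T" for v
    using that g_img by (simp add: f_def f_inv_into_f)
  have "f (root T) = ([], root_label R)"
    unfolding f_def using g_inj rule_nodes.root by (rule inv_into_f_eq) (simp add: g_def d_Nil)
  moreover have "(x, y) \<in> edges T \<longleftrightarrow> (f x, f y) \<in> edges (rule_tree R)"
    if "x \<in> verts T" "y \<in> verts T" for x y
    using g_edge[of "f x" "f y"] bij_betwE[OF f_bij] gf that by simp
  ultimately show ?thesis
    unfolding rooted_iso_def using f_bij by (intro exI[of _ f]) (simp add: rule_tree_def)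
qed

text \<open>
  If no label is produced twice, the enumeration of the children need not be given: the child with
  index \<open>i\<close> is the one that carries the \<open>i\<close>-th label.
\<close>
lemma (in graded_tree) rooted_iso_rule_tree_distinct:
  fixes R :: "'l succession_rule" and lab :: "'v \<Rightarrow> 'l"
  assumes lab_root: "lab (root T) = root_label R"
    and dist: "\<And>l. distinct (productions R l)"
    and lab_bij: "\<And>v. v \<in> verts T \<Longrightarrow>
      bij_betw lab {w. (v, w) \<in> edges T} (set (productions R (lab v)))"
  shows "rooted_iso T (rule_tree R)"
proof -
  define c where "c = (\<lambda>v i. inv_into {w. (v, w) \<in> edges T} lab (productions R (lab v) ! i))"
  have "bij_betw (c v) {..<length (productions R (lab v))} {w. (v, w) \<in> edges T}"
    if v: "v \<in> verts T" for v
    using bij_betw_trans[OF bij_betw_nth[OF dist refl refl] bij_betw_inv_into[OF lab_bij[OF v]]]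
    by (simp add: o_def c_def)
  moreover have "lab (c v i) = productions R (lab v) ! i"
    if "v \<in> verts T" "i < length (productions R (lab v))" for v i
    using bij_betw_inv_into_right[OF lab_bij[OF that(1)]] that(2) by (simp add: c_def)
  ultimately show ?thesis using rooted_iso_rule_tree[where lab = lab and c = c] lab_root by blast
qed

section \<open>Inserting an entry on the right\<close>

definition make_room :: "nat \<Rightarrow> nat \<Rightarrow> nat" where
  "make_room a x = (if x < a then x else x + 1)"

lemma insert_right_eq: "insert_right xs a = map (make_room a) xs @ [a]"
  by (simp add: insert_right_def make_room_def cong: map_cong)

lemma make_room_less_iff [simp]: "make_room a x < make_room a y \<longleftrightarrow> x < y"
  by (auto simp: make_room_def)

lemma length_insert_right [simp]: "length (insert_right xs a) = Suc (length xs)"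
  by (simp add: insert_right_def)

lemma inj_make_room: "inj (make_room a)"
  by (rule injI) (auto simp: make_room_def split: if_splits)

lemma make_room_image:
  assumes "1 \<le> a" "a \<le> n + 1"
  shows "make_room a ` {1..n} = {1..n + 1} - {a}"
proof (intro equalityI subsetI)
  fix y assume y: "y \<in> {1..n + 1} - {a}"
  show "y \<in> make_room a ` {1..n}"
  proof (cases "y < a")
    case True
    then show ?thesis using y assms by (intro image_eqI[of _ _ y]) (auto simp: make_room_def)
  next
    case False
    then show ?thesis using y assms by (intro image_eqI[of _ _ "y - 1"]) (auto simp: make_room_def)
  qed
qed (use assms in \<open>auto simp: make_room_def\<close>)

lemma insert_right_inject [simp]:
  "insert_right xs a = insert_right ys b \<longleftrightarrow> xs = ys \<and> a = b"
  using inj_make_room by (auto simp: insert_right_eq inj_map_eq_map)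

lemma insert_right_permutation:
  assumes "xs \<in> permutations_of_set {1..n}" "1 \<le> a" "a \<le> n + 1"
  shows "insert_right xs a \<in> permutations_of_set {1..n + 1}"
proof -
  have "set (map (make_room a) xs) = {1..n + 1} - {a}"
    using make_room_image[OF assms(2,3)] assms(1) by (simp add: permutations_of_set_def)
  moreover have "distinct (map (make_room a) xs)"
    using assms(1) inj_on_subset[OF inj_make_room] by (auto simp: permutations_of_set_def distinct_map)
  ultimately show ?thesis using assms by (auto simp: permutations_of_set_def insert_right_eq)
qed

text \<open>
  The values other than the last value \<open>a\<close> are exactly those that \<^const>\<open>make_room\<close> leaves after making
  room for \<open>a\<close>, so they can be pulled back to \<open>{1..n}\<close>.
\<close>
lemma permutation_is_insert_right:
  assumes "ys \<in> permutations_of_set {1..n + 1}"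
  obtains xs a where "xs \<in> permutations_of_set {1..n}" "1 \<le> a" "a \<le> n + 1" "ys = insert_right xs a"
proof -
  have ys: "set ys = {1..n + 1}" "distinct ys" using assms by (auto simp: permutations_of_set_def)
  then have "ys \<noteq> []" by auto
  then obtain zs a where zs: "ys = zs @ [a]" by (metis rev_exhaust)
  have a: "1 \<le> a" "a \<le> n + 1" using ys zs by auto
  have set_zs: "set zs = make_room a ` {1..n}" using ys zs make_room_image[OF a] by auto
  then have "zs \<in> range (map (make_room a))" using ex_map_conv[of zs "make_room a"] by auto
  then obtain xs where xs: "zs = map (make_room a) xs" by blast
  have "set xs = {1..n}" using set_zs inj_make_room by (simp add: xs inj_image_eq_iff)
  moreover have "distinct xs" using ys zs xs by (simp add: distinct_map)
  ultimately show thesis using that[of xs a] a zs xs by (auto simp: permutations_of_set_def insert_right_eq)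
qed

section \<open>Active sites\<close>

text \<open>
  The entries \<open>2\<close>, \<open>1\<close>, \<open>4\<close> that become an occurrence of \<open>2143\<close> once \<open>a\<close> is inserted. Insertion raises the
  entries \<open>\<ge> a\<close> by one; this is why \<open>a\<close> may equal the entry that plays \<open>4\<close>, but not the one that
  plays \<open>2\<close>.
\<close>
definition barred :: "nat list \<Rightarrow> nat \<Rightarrow> bool" where
  "barred xs a \<longleftrightarrow> (\<exists>i j. i < j \<and> j + 1 < length xs \<and>
     xs ! j < xs ! i \<and> xs ! i < a \<and> a \<le> xs ! (j + 1))"

lemma plane_snoc:
  "plane (xs @ [a]) \<longleftrightarrow> plane xs \<and>
     \<not> (\<exists>i j. i < j \<and> j + 1 < length xs \<and> xs ! j < xs ! i \<and> xs ! i < a \<and> a < xs ! (j + 1))"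
proof -
  define occ where "occ = (\<lambda>(ys :: nat list) i j k. i < j \<and> j + 1 < k \<and>
    ys ! j < ys ! i \<and> ys ! i < ys ! k \<and> ys ! k < ys ! (j + 1))"
  have plane: "plane ys \<longleftrightarrow> \<not> (\<exists>i j k. k < length ys \<and> occ ys i j k)" for ys
    unfolding plane_def occ_def by blast
  have old: "occ (xs @ [a]) i j k \<longleftrightarrow> occ xs i j k" if "k < length xs" for i j k
    using that by (auto simp: occ_def nth_append)
  have new: "occ (xs @ [a]) i j (length xs) \<longleftrightarrow>
      i < j \<and> j + 1 < length xs \<and> xs ! j < xs ! i \<and> xs ! i < a \<and> a < xs ! (j + 1)" for i j
    by (auto simp: occ_def nth_append)
  have "\<not> plane (xs @ [a]) \<longleftrightarrow>
      (\<exists>i j k. k < length xs \<and> occ (xs @ [a]) i j k) \<or> (\<exists>i j. occ (xs @ [a]) i j (length xs))"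
    unfolding plane by (auto simp: less_Suc_eq)
  also have "(\<exists>i j k. k < length xs \<and> occ (xs @ [a]) i j k) \<longleftrightarrow> \<not> plane xs"
    unfolding plane using old by blast
  finally show ?thesis unfolding new by blast
qed

lemma plane_map:
  fixes f :: "nat \<Rightarrow> nat"
  assumes "\<And>x y. f x < f y \<longleftrightarrow> x < y"
  shows "plane (map f xs) \<longleftrightarrow> plane xs"
  unfolding plane_def length_map
  by (intro arg_cong[of _ _ Not] ex_cong1 conj_cong refl) (simp_all add: assms)

lemma plane_insert_right: "plane (insert_right xs a) \<longleftrightarrow> plane xs \<and> \<not> barred xs a"
proof -
  have "make_room a x < a \<longleftrightarrow> x < a" "a < make_room a x \<longleftrightarrow> a \<le> x" for x
    by (auto simp: make_room_def)
  then have "(\<exists>i j. i < j \<and> j + 1 < length (map (make_room a) xs) \<and>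
      map (make_room a) xs ! j < map (make_room a) xs ! i \<and> map (make_room a) xs ! i < a \<and>
      a < map (make_room a) xs ! (j + 1)) \<longleftrightarrow> barred xs a"
    unfolding barred_def length_map by (intro ex_cong1 conj_cong refl) simp_all
  then show ?thesis by (simp only: insert_right_eq plane_snoc plane_map[OF make_room_less_iff])
qed

definition sites :: "nat list \<Rightarrow> nat set" where
  "sites xs = {a \<in> {1..length xs + 1}. \<not> barred xs a}"

text \<open>
  A site \<open>b\<close> of the longer permutation comes from the site \<open>b\<close> or \<open>b - 1\<close> of the shorter one, according
  to whether \<open>b \<le> a\<close>; this accounts for the old adjacent pairs in the role of \<open>14\<close>. The new adjacent
  pair \<open>z, a\<close>, with \<open>z\<close> the old last entry, bars \<open>b \<le> a\<close> whenever some value strictly between \<open>z\<close> and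
  \<open>b\<close> occurs earlier. Since all values occur, \<open>z + 1\<close> serves as soon as \<open>z + 1 < b\<close>.
\<close>
lemma barred_insert_right:
  assumes xs: "xs \<in> permutations_of_set {1..n}" and n: "1 \<le> n" and a: "a \<le> n + 1"
  shows "barred (insert_right xs a) b \<longleftrightarrow>
    (if b \<le> a then barred xs b \<or> last xs + 1 < b else barred xs (b - 1))"
proof -
  let ?ys = "insert_right xs a"
  have set_xs: "set xs = {1..n}" and len_xs: "length xs = n"
    using xs by (auto simp: permutations_of_set_def dest: distinct_card)
  have old: "?ys ! i = make_room a (xs ! i)" if "i < n" for i
    using that by (simp add: insert_right_eq nth_append len_xs)
  have new: "?ys ! n = a" by (simp add: insert_right_eq nth_append len_xs)
  have len: "length ?ys = Suc n" by (simp add: insert_right_eq len_xs)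
  have last: "last xs = xs ! (n - 1)" using n len_xs by (metis last_conv_nth list.size(3) not_one_le_zero)
  have "barred ?ys b \<longleftrightarrow>
      (\<exists>i j. i < j \<and> j + 1 < n \<and> ?ys ! j < ?ys ! i \<and> ?ys ! i < b \<and> b \<le> ?ys ! (j + 1)) \<or>
      (\<exists>i < n - 1. ?ys ! (n - 1) < ?ys ! i \<and> ?ys ! i < b \<and> b \<le> a)"
    (is "_ \<longleftrightarrow> ?A \<or> ?B")
  proof -
    define Q where "Q = (\<lambda>i j. ?ys ! j < ?ys ! i \<and> ?ys ! i < b \<and> b \<le> ?ys ! (j + 1))"
    have split: "j + 1 < Suc n \<longleftrightarrow> j + 1 < n \<or> j = n - 1" for j using n by auto
    have "barred ?ys b \<longleftrightarrow> (\<exists>i j. i < j \<and> j + 1 < Suc n \<and> Q i j)"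
      unfolding barred_def len Q_def by blast
    also have "\<dots> \<longleftrightarrow> (\<exists>i j. i < j \<and> j + 1 < n \<and> Q i j) \<or> (\<exists>i < n - 1. Q i (n - 1))"
      unfolding split by blast
    finally show ?thesis unfolding Q_def using new n by simp
  qed
  \<comment> \<open>\<open>?A\<close> collects the old adjacent pairs, \<open>?B\<close> the pair formed by the old and the new last entry.\<close>
  moreover have "?A \<longleftrightarrow> barred xs (if b \<le> a then b else b - 1)"
  proof -
    have "make_room a x < b \<longleftrightarrow> x < (if b \<le> a then b else b - 1)"
      "b \<le> make_room a x \<longleftrightarrow> (if b \<le> a then b else b - 1) \<le> x" for x
      by (auto simp: make_room_def)
    then show ?thesis
      unfolding barred_def len_xs by (intro ex_cong1 conj_cong refl) (simp_all add: old)
  qed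
  moreover have "?B \<longleftrightarrow> b \<le> a \<and> last xs + 1 < b"
  proof
    assume ?B
    then obtain i where i: "i < n - 1" "?ys ! (n - 1) < ?ys ! i" "?ys ! i < b" "b \<le> a" by blast
    then have "last xs < xs ! i" "xs ! i \<le> ?ys ! i" using n by (auto simp: old last make_room_def split: if_splits)
    then show "b \<le> a \<and> last xs + 1 < b" using i by simp
  next
    assume b: "b \<le> a \<and> last xs + 1 < b"
    then have "last xs + 1 \<in> set xs" using a by (simp add: set_xs)
    then obtain i where i: "i < n" "xs ! i = last xs + 1" by (auto simp: in_set_conv_nth len_xs)
    then have "i \<noteq> n - 1" using last by auto
    with i n have "i < n - 1" by simp
    moreover have "?ys ! (n - 1) < ?ys ! i" using i n last by (simp add: old)
    moreover have "?ys ! i < b" using i b by (simp add: old make_room_def)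
    ultimately show ?B using b by blast
  qed
  ultimately show ?thesis by auto
qed

lemma sites_insert_right:
  assumes xs: "xs \<in> permutations_of_set {1..n}" and n: "1 \<le> n" and a: "1 \<le> a" "a \<le> n + 1"
  shows "sites (insert_right xs a) =
    {b \<in> sites xs. b \<le> a \<and> b \<le> last xs + 1} \<union> Suc ` {b \<in> sites xs. a \<le> b}"
proof -
  have len: "length xs = n" using xs by (auto simp: permutations_of_set_def dest: distinct_card)
  have shift: "b \<in> Suc ` {b \<in> sites xs. a \<le> b} \<longleftrightarrow> a < b \<and> b - 1 \<in> sites xs" for b
    by (cases b) auto
  show ?thesis
  proof (rule set_eqI)
    fix b
    show "b \<in> sites (insert_right xs a) \<longleftrightarrow>
      b \<in> {b \<in> sites xs. b \<le> a \<and> b \<le> last xs + 1} \<union> Suc ` {b \<in> sites xs. a \<le> b}"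
      unfolding Un_iff shift using a
      by (auto simp: sites_def barred_insert_right[OF xs n a(2)] len)
  qed
qed

text \<open>
  If the site just above the last entry were barred, the last entry itself would already be the \<open>3\<close>
  of an occurrence of \<open>2143\<close>.
\<close>
lemma last_site:
  assumes xs: "xs \<in> permutations_of_set {1..n}" and n: "1 \<le> n" and "plane xs"
  shows "last xs + 1 \<in> sites xs"
proof -
  have set_xs: "set xs = {1..n}" and dist: "distinct xs" and len: "length xs = n"
    using xs by (auto simp: permutations_of_set_def dest: distinct_card)
  have ne: "xs \<noteq> []" using n len by auto
  then have last: "last xs = xs ! (n - 1)" by (simp add: last_conv_nth len)
  have "\<not> barred xs (last xs + 1)"
  proof
    assume "barred xs (last xs + 1)"
    then obtain i j where ij: "i < j" "j + 1 < n" "xs ! j < xs ! i" "xs ! i < last xs + 1"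
        "last xs + 1 \<le> xs ! (j + 1)"
      by (auto simp: barred_def len)
    have "xs ! i \<noteq> last xs"
      using ij(1,2) nth_eq_iff_index_eq[OF dist, of i "n - 1"] by (simp add: last len)
    moreover have "j + 1 \<noteq> n - 1" using ij(5) last by auto
    ultimately have "j + 1 < n - 1 \<and> n - 1 < length xs \<and> xs ! i < xs ! (n - 1) \<and> xs ! (n - 1) < xs ! (j + 1)"
      using ij last len by auto
    then show False using \<open>plane xs\<close> ij unfolding plane_def by blast
  qed
  moreover have "last xs \<in> set xs" using ne by simp
  ultimately show ?thesis by (simp add: sites_def len set_xs)
qed

section \<open>Labels\<close>

definition label :: "nat list \<Rightarrow> nat \<times> nat" where
  "label xs = (card {b \<in> sites xs. last xs < b}, card {b \<in> sites xs. b \<le> last xs})"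

lemma bij_betw_rank_from_top:
  fixes A :: "'a :: linorder set"
  assumes "finite A"
  shows "bij_betw (\<lambda>a. card {b \<in> A. a \<le> b}) A {1..card A}"
proof -
  let ?r = "\<lambda>a. card {b \<in> A. a \<le> b}"
  have less: "?r a' < ?r a" if "a \<in> A" "a < a'" for a a'
  proof (rule psubset_card_mono)
    show "{b \<in> A. a' \<le> b} \<subset> {b \<in> A. a \<le> b}"
    proof
      show "{b \<in> A. a' \<le> b} \<subseteq> {b \<in> A. a \<le> b}" using that by auto
      have "a \<in> {b \<in> A. a \<le> b}" "a \<notin> {b \<in> A. a' \<le> b}" using that by auto
      then show "{b \<in> A. a' \<le> b} \<noteq> {b \<in> A. a \<le> b}" by blast
    qed
  qed (use assms in simp)
  then have inj: "inj_on ?r A"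
    by (intro linorder_inj_onI) (auto simp: neq_iff)
  have "?r ` A \<subseteq> {1..card A}"
  proof
    fix r assume "r \<in> ?r ` A"
    then obtain a where "a \<in> A" "r = ?r a" by blast
    then show "r \<in> {1..card A}"
      using assms by (auto simp: card_gt_0_iff Suc_le_eq intro!: card_mono)
  qed
  moreover have "card (?r ` A) = card {1..card A}" by (simp add: card_image[OF inj])
  ultimately have "?r ` A = {1..card A}" by (intro card_subset_eq) auto
  with inj show ?thesis by (simp add: bij_betw_def)
qed

lemma distinct_productions_Omega_semi: "distinct (productions Omega_semi l)"
  by (cases l) (auto simp: Omega_semi_def distinct_map inj_on_def)

text \<open>
  The second family is reindexed from the top, \<open>i = k + 1 - r\<close>, so that in both families \<open>r\<close> is the
  rank from the top of the inserted site among the sites of its kind.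
\<close>
lemma set_productions_Omega_semi:
  "set (productions Omega_semi (h, k)) =
     (\<lambda>r. (r, k + 1)) ` {1..h} \<union> (\<lambda>r. (h + r, k + 1 - r)) ` {1..k}"
proof -
  have "(\<lambda>i. (h + k + 1 - i, i)) ` {1..k} = (\<lambda>r. (h + r, k + 1 - r)) ` {1..k}"
  proof (intro equalityI subsetI; elim imageE)
    fix x i assume "x = (h + k + 1 - i, i)" "i \<in> {1..k}"
    then show "x \<in> (\<lambda>r. (h + r, k + 1 - r)) ` {1..k}" by (intro image_eqI[of _ _ "k + 1 - i"]) auto
  next
    fix x i assume "x = (h + i, k + 1 - i)" "i \<in> {1..k}"
    then show "x \<in> (\<lambda>i. (h + k + 1 - i, i)) ` {1..k}" by (intro image_eqI[of _ _ "k + 1 - i"]) auto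
  qed
  then show ?thesis
    by (simp add: Omega_semi_def atLeastLessThanSuc_atLeastAtMost del: upt_Suc)
qed

text \<open>
  The sites of \<open>xs \<cdot> a\<close> above its last entry \<open>a\<close> are the successors of the sites \<open>b \<ge> a\<close> of \<open>xs\<close>; those not
  above \<open>a\<close> are the sites \<open>b \<le> a\<close> of \<open>xs\<close> that do not exceed \<open>last xs + 1\<close>. For \<open>a > last xs\<close> the latter
  are the lower sites of \<open>xs\<close> and the extra site \<open>last xs + 1\<close>. For \<open>a \<le> last xs\<close> they and the lower
  sites \<open>b \<ge> a\<close> cover the lower sites, overlapping in \<open>a\<close> alone, whence the count \<open>k + 1 - r\<close>.
\<close>
lemma label_insert_right:
  assumes xs: "xs \<in> permutations_of_set {1..n}" and n: "1 \<le> n" and "plane xs"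
    and a: "a \<in> sites xs" and label: "label xs = (h, k)"
  shows "last xs < a \<Longrightarrow> label (insert_right xs a) = (card {b \<in> {b \<in> sites xs. last xs < b}. a \<le> b}, k + 1)"
    and "a \<le> last xs \<Longrightarrow> label (insert_right xs a) =
      (h + card {b \<in> {b \<in> sites xs. b \<le> last xs}. a \<le> b}, k + 1 - card {b \<in> {b \<in> sites xs. b \<le> last xs}. a \<le> b})"
proof -
  let ?S = "sites xs"
  have fin: "finite ?S" by (simp add: sites_def)
  have len: "length xs = n" using xs by (auto simp: permutations_of_set_def dest: distinct_card)
  have a_range: "1 \<le> a" "a \<le> n + 1" using a by (auto simp: sites_def len)
  have h: "h = card {b \<in> ?S. last xs < b}" and k: "k = card {b \<in> ?S. b \<le> last xs}"
    using label by (simp_all add: label_def)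
  have last: "last (insert_right xs a) = a" by (simp add: insert_right_eq)
  note S' = sites_insert_right[OF xs n a_range]
  have "{b \<in> sites (insert_right xs a). a < b} = Suc ` {b \<in> ?S. a \<le> b}"
    unfolding S' by auto
  then have fst: "fst (label (insert_right xs a)) = card {b \<in> ?S. a \<le> b}"
    by (simp add: label_def last card_image)
  have "{b \<in> sites (insert_right xs a). b \<le> a} = {b \<in> ?S. b \<le> a \<and> b \<le> last xs + 1}"
    unfolding S' by auto
  then have snd: "snd (label (insert_right xs a)) = card {b \<in> ?S. b \<le> a \<and> b \<le> last xs + 1}"
    by (simp add: label_def last)
  show "label (insert_right xs a) = (card {b \<in> {b \<in> ?S. last xs < b}. a \<le> b}, k + 1)"
    if "last xs < a"
  proof -
    have "{b \<in> {b \<in> ?S. last xs < b}. a \<le> b} = {b \<in> ?S. a \<le> b}" using that by auto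
    moreover have "{b \<in> ?S. b \<le> a \<and> b \<le> last xs + 1} = insert (last xs + 1) {b \<in> ?S. b \<le> last xs}"
      using that last_site[OF xs n \<open>plane xs\<close>] by auto
    ultimately show ?thesis using fst snd fin k by (simp add: prod_eq_iff)
  qed
  show "label (insert_right xs a) =
      (h + card {b \<in> {b \<in> ?S. b \<le> last xs}. a \<le> b}, k + 1 - card {b \<in> {b \<in> ?S. b \<le> last xs}. a \<le> b})"
    if "a \<le> last xs"
  proof -
    let ?above = "{b \<in> {b \<in> ?S. b \<le> last xs}. a \<le> b}" and ?below = "{b \<in> ?S. b \<le> a}"
    have "{b \<in> ?S. a \<le> b} = {b \<in> ?S. last xs < b} \<union> ?above" using that by auto
    then have "card {b \<in> ?S. a \<le> b} = h + card ?above"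
      using fin by (simp add: h card_Un_disjoint disjoint_iff)
    moreover have "card ?below + card ?above = k + 1"
    proof -
      have "?below \<union> ?above = {b \<in> ?S. b \<le> last xs}" "?below \<inter> ?above = {a}"
        using that a by auto
      then show ?thesis using card_Un_Int[of ?below ?above] fin by (simp only: k) simp
    qed
    moreover have "{b \<in> ?S. b \<le> a \<and> b \<le> last xs + 1} = ?below" using that by auto
    ultimately show ?thesis using fst snd by (simp add: prod_eq_iff)
  qed
qed

lemma bij_betw_label_insert_right:
  assumes xs: "xs \<in> permutations_of_set {1..n}" and n: "1 \<le> n" and "plane xs"
  shows "bij_betw (\<lambda>a. label (insert_right xs a)) (sites xs) (set (productions Omega_semi (label xs)))"
proof -
  let ?U = "{b \<in> sites xs. last xs < b}" and ?L = "{b \<in> sites xs. b \<le> last xs}"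
  obtain h k where hk: "label xs = (h, k)" by fastforce
  then have h: "h = card ?U" and k: "k = card ?L" by (simp_all add: label_def)
  have fin: "finite ?U" "finite ?L" by (simp_all add: sites_def)
  have "bij_betw (\<lambda>r. (r, k + 1)) {1..h} ((\<lambda>r. (r, k + 1)) ` {1..h})"
    by (intro bij_betw_imageI inj_onI) auto
  from bij_betw_trans[OF bij_betw_rank_from_top[OF fin(1), folded h] this]
  have "bij_betw (\<lambda>a. label (insert_right xs a)) ?U ((\<lambda>r. (r, k + 1)) ` {1..h})"
    by (rule bij_betw_cong[THEN iffD1, rotated])
      (use label_insert_right(1)[OF assms _ hk] in auto)
  moreover have "bij_betw (\<lambda>r. (h + r, k + 1 - r)) {1..k} ((\<lambda>r. (h + r, k + 1 - r)) ` {1..k})"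
    by (intro bij_betw_imageI inj_onI) auto
  from bij_betw_trans[OF bij_betw_rank_from_top[OF fin(2), folded k] this]
  have "bij_betw (\<lambda>a. label (insert_right xs a)) ?L ((\<lambda>r. (h + r, k + 1 - r)) ` {1..k})"
    by (rule bij_betw_cong[THEN iffD1, rotated])
      (use label_insert_right(2)[OF assms _ hk] in auto)
  \<comment> \<open>The second component is \<open>k + 1\<close> in the first family and at most \<open>k\<close> in the second.\<close>
  moreover have "(\<lambda>r. (r, k + 1)) ` {1..h} \<inter> (\<lambda>r. (h + r, k + 1 - r)) ` {1..k} = {}" by auto
  ultimately have "bij_betw (\<lambda>a. label (insert_right xs a)) (?U \<union> ?L)
      ((\<lambda>r. (r, k + 1)) ` {1..h} \<union> (\<lambda>r. (h + r, k + 1 - r)) ` {1..k})"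
    by (rule bij_betw_combine)
  moreover have "?U \<union> ?L = sites xs" by auto
  ultimately show ?thesis by (simp only: hk set_productions_Omega_semi)
qed

section \<open>The tree of plane permutations\<close>

lemma plane_perms_iff:
  "xs \<in> plane_perms \<longleftrightarrow> xs \<in> permutations_of_set {1..length xs} \<and> 1 \<le> length xs \<and> plane xs"
proof -
  have "n = length xs" if "xs \<in> permutations_of_set {1..n}" for n
    using that distinct_card[of xs] by (simp add: permutations_of_set_def)
  then show ?thesis by (auto simp: plane_perms_def)
qed

lemma edge_plane_tree_iff:
  "(xs, ys) \<in> edges plane_tree \<longleftrightarrow> xs \<in> plane_perms \<and> ys \<in> insert_right xs ` sites xs"
  by (auto simp: plane_tree_def sites_def plane_insert_right plane_perms_iff)

lemma graded_plane_tree: "graded_tree plane_tree length"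
proof
  have "[1] \<in> plane_perms" by (auto simp: plane_perms_iff permutations_of_set_def plane_def)
  then show "root plane_tree \<in> verts plane_tree" by (simp add: plane_tree_def)
  show "edges plane_tree \<subseteq> verts plane_tree \<times> verts plane_tree"
    using insert_right_permutation by (fastforce simp: plane_tree_def plane_perms_iff)
  show "length (root plane_tree) = 1" by (simp add: plane_tree_def)
  show "1 \<le> length xs" if "xs \<in> verts plane_tree" for xs
    using that by (simp add: plane_tree_def plane_perms_iff)
  show "length ys = Suc (length xs)" if "(xs, ys) \<in> edges plane_tree" for xs ys
    using that by (auto simp: plane_tree_def)
  show "\<exists>!xs. (xs, ys) \<in> edges plane_tree"
    if ys: "ys \<in> verts plane_tree" "ys \<noteq> root plane_tree" for ys
  proof (rule ex_ex1I)
    have ys_perm: "ys \<in> permutations_of_set {1..length ys}" "1 \<le> length ys" "plane ys"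
      and "ys \<noteq> [1]"
      using ys by (auto simp: plane_tree_def plane_perms_iff)
    obtain n where n: "length ys = n + 1" using ys_perm(2) by (metis Suc_eq_plus1 not0_implies_Suc not_one_le_zero)
    obtain xs a where xs: "xs \<in> permutations_of_set {1..n}" "1 \<le> a" "a \<le> n + 1" "ys = insert_right xs a"
      using permutation_is_insert_right ys_perm(1) unfolding n by blast
    have len: "length xs = n" using xs(4) n by simp
    have "1 \<le> n"
    proof (rule ccontr)
      assume "\<not> 1 \<le> n"
      then have "xs = []" "a = 1" using len xs by auto
      then show False using xs(4) \<open>ys \<noteq> [1]\<close> by (simp add: insert_right_def)
    qed
    then have "(xs, ys) \<in> edges plane_tree"
      using xs ys_perm(3) len by (auto simp: edge_plane_tree_iff plane_perms_iff sites_def plane_insert_right)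
    then show "\<exists>xs. (xs, ys) \<in> edges plane_tree" by blast
  qed (auto simp: edge_plane_tree_iff)
qed

lemma infinite_plane_perms: "infinite plane_perms"
proof
  assume "finite plane_perms"
  moreover have "[1..<n + 2] \<in> plane_perms" for n
    by (auto simp: plane_perms_iff permutations_of_set_def plane_def simp del: upt_Suc)
  then have "range (\<lambda>n. [1..<n + 2]) \<subseteq> plane_perms" by blast
  moreover have "inj (\<lambda>n. [1..<n + 2 :: nat])"
    by (rule injI) (auto dest!: arg_cong[where f = length] simp del: upt_Suc)
  ultimately show False using finite_subset finite_imageD infinite_UNIV_nat by blast
qed

lemma label_root: "label [1] = (1, 1)"
proof -
  have "sites [1] = {1, 2}" by (auto simp: sites_def barred_def)
  moreover have "{b \<in> {1, 2}. 1 < b} = {2 :: nat}" "{b \<in> {1, 2}. b \<le> 1} = {1 :: nat}" by auto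
  ultimately show ?thesis by (simp add: label_def)
qed

theorem proposition5:
  shows "generating_tree plane_perms length plane_tree \<and>
         rooted_iso plane_tree (rule_tree Omega_semi)"
proof
  interpret graded_tree plane_tree length by (rule graded_plane_tree)
  have verts: "verts plane_tree = plane_perms" by (simp add: plane_tree_def)
  show "generating_tree plane_perms length plane_tree"
    using rooted_tree level_eq_size infinite_plane_perms by (simp add: generating_tree_def verts)
  show "rooted_iso plane_tree (rule_tree Omega_semi)"
  proof (rule rooted_iso_rule_tree_distinct)
    show "label (root plane_tree) = root_label Omega_semi"
      using label_root by (simp add: plane_tree_def Omega_semi_def)
    show "distinct (productions Omega_semi l)" for l by (rule distinct_productions_Omega_semi)
    fix xs assume "xs \<in> verts plane_tree"
    then have xs: "xs \<in> plane_perms" by (simp add: verts)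
    let ?C = "{ys. (xs, ys) \<in> edges plane_tree}"
    have "?C = insert_right xs ` sites xs" using xs by (auto simp: edge_plane_tree_iff)
    then have "bij_betw (insert_right xs) (sites xs) ?C"
      by (auto intro!: bij_betw_imageI inj_onI)
    moreover have "bij_betw (label \<circ> insert_right xs) (sites xs) (set (productions Omega_semi (label xs)))"
      using xs bij_betw_label_insert_right by (auto simp: o_def plane_perms_iff)
    ultimately show "bij_betw label ?C (set (productions Omega_semi (label xs)))"
      using bij_betw_comp_iff by blast
  qed
qed

end
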